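(* For every graph $\mathcal{G}$, the Shannon capacity of $\mathcal{G}$ is given by $$\Theta(\mathcal{G})=\inf_f f(\overline{\mathcal{G}}),$$ where $\overline{\mathcal{G}}$ is the complement graph and the infimum ranges over all graph invariants $f$, with values in $\mathbb{R}_{>0}$, that are monotone under graph maps ($f(\mathcal{H}_1)\leq f(\mathcal{H}_2)$ whenever there is a graph map $\mathcal{H}_1\to\mathcal{H}_2$), multiplicative under disjunctive products ($f(\mathcal{H}_1\ast\mathcal{H}_2)=f(\mathcal{H}_1)f(\mathcal{H}_2)$), and normalized such that $f(\mathcal{K}_2)=2$.
   Context: Graphs are finite, simple, undirected, without loops or parallel edges, and with at least one vertex (the edge set may be empty). A graph map $\mathcal{G}\to\mathcal{H}$ is a function on vertices taking adjacent vertices to adjacent vertices. The disjunctive product $\mathcal{G}\ast\mathcal{H}$ has as vertices the pairs $(v,w)$ with $v$ a vertex of $\mathcal{G}$ and $w$ a vertex of $\mathcal{H}$, with $(v,w)\sim(v',w')$ iff $v\sim v'$ or $w\sim w'$. $\mathcal{K}_n$ is the complete graph on $n$ vertices and $\omega$ the clique number. The Shannon capacity is $\Theta(\mathcal{G})=\lim_{n\to\infty}\sqrt[n]{\omega(\overline{\mathcal{G}}^{\ast n})}$, where $\overline{\mathcal{G}}^{\ast n}$ is the $n$-fold disjunctive product of the complement graph with itself. *)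

theory Defs
  imports "HOL-Analysis.Analysis" "Graph_Theory.Graph_Theory"
begin

text \<open>
  A finite simple undirected graph is a symmetric loopfree digraph without parallel arcs
  (\<^locale>\<open>pair_graph\<close>): an undirected edge is the pair of its two orientations.
  \<^locale>\<open>pair_graph\<close> admits the null graph, which is excluded here.
\<close>

definition simple_graph :: "'a pair_pre_digraph \<Rightarrow> bool" where
  "simple_graph G \<longleftrightarrow> pair_graph G \<and> pverts G \<noteq> {}"

definition graph_map :: "('a \<Rightarrow> 'b) \<Rightarrow> 'a pair_pre_digraph \<Rightarrow> 'b pair_pre_digraph \<Rightarrow> bool" where
  "graph_map \<phi> G H \<longleftrightarrow>
     (\<forall>v\<in>pverts G. \<phi> v \<in> pverts H) \<and> (\<forall>(u, v)\<in>parcs G. (\<phi> u, \<phi> v) \<in> parcs H)"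

definition complement_graph :: "'a pair_pre_digraph \<Rightarrow> 'a pair_pre_digraph" where
  "complement_graph G =
     \<lparr> pverts = pverts G,
       parcs = {(u, v). u \<in> pverts G \<and> v \<in> pverts G \<and> u \<noteq> v \<and> (u, v) \<notin> parcs G} \<rparr>"

definition disj_prod ::
  "'a pair_pre_digraph \<Rightarrow> 'b pair_pre_digraph \<Rightarrow> ('a \<times> 'b) pair_pre_digraph" where
  "disj_prod G H =
     \<lparr> pverts = pverts G \<times> pverts H,
       parcs = {((v, w), (v', w')). (v, w) \<in> pverts G \<times> pverts H \<and> (v', w') \<in> pverts G \<times> pverts H \<and>
                  ((v, v') \<in> parcs G \<or> (w, w') \<in> parcs H)} \<rparr>"

definition relabel :: "('a \<Rightarrow> 'b) \<Rightarrow> 'a pair_pre_digraph \<Rightarrow> 'b pair_pre_digraph" where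
  "relabel h G = \<lparr> pverts = h ` pverts G, parcs = map_prod h h ` parcs G \<rparr>"

text \<open>
  The vertices of the iterated product are encoded as lists of length \<open>n\<close>, so that all
  powers have the same type; the zeroth power is the one-vertex graph, the unit of
  \<^const>\<open>disj_prod\<close> up to isomorphism.
\<close>

primrec disj_power :: "'a pair_pre_digraph \<Rightarrow> nat \<Rightarrow> 'a list pair_pre_digraph" where
  "disj_power G 0 = \<lparr> pverts = {[]}, parcs = {} \<rparr>"
| "disj_power G (Suc n) = relabel (\<lambda>(v, vs). v # vs) (disj_prod G (disj_power G n))"

definition clique_number :: "'a pair_pre_digraph \<Rightarrow> nat" where
  "clique_number G =
     Max {n. \<exists>K. complete_digraph n (with_proj K) \<and> subgraph (with_proj K) (with_proj G)}"

definition shannon_capacity :: "'a pair_pre_digraph \<Rightarrow> real" where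
  "shannon_capacity G =
     lim (\<lambda>n. root n (real (clique_number (disj_power (complement_graph G) n))))"

text \<open>
  A graph invariant has to be defined on graphs over all vertex types at once. Since every finite
  graph is isomorphic to one with vertices in \<^typ>\<open>nat\<close>, an invariant is a
  function on the latter, and \<open>inv_value f\<close> is its extension to arbitrary finite graphs.
\<close>

definition graph_invariant :: "(nat pair_pre_digraph \<Rightarrow> real) \<Rightarrow> bool" where
  "graph_invariant f \<longleftrightarrow>
     (\<forall>G H. simple_graph G \<and> simple_graph H \<and> digraph_iso (with_proj G) (with_proj H) \<longrightarrow> f G = f H)"

definition inv_value :: "(nat pair_pre_digraph \<Rightarrow> real) \<Rightarrow> 'a pair_pre_digraph \<Rightarrow> real" where
  "inv_value f G = f (SOME H. simple_graph H \<and> digraph_iso (with_proj G) (with_proj H))"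

definition admissible_invariant :: "(nat pair_pre_digraph \<Rightarrow> real) \<Rightarrow> bool" where
  "admissible_invariant f \<longleftrightarrow>
     graph_invariant f \<and>
     (\<forall>H. simple_graph H \<longrightarrow> f H > 0) \<and>
     (\<forall>H1 H2. simple_graph H1 \<and> simple_graph H2 \<and> (\<exists>\<phi>. graph_map \<phi> H1 H2) \<longrightarrow> f H1 \<le> f H2) \<and>
     (\<forall>H1 H2. simple_graph H1 \<and> simple_graph H2 \<longrightarrow> inv_value f (disj_prod H1 H2) = f H1 * f H2) \<and>
     (\<forall>K. complete_digraph 2 (with_proj K) \<longrightarrow> f K = 2)"

text \<open>The choice in \<^const>\<open>inv_value\<close> is immaterial and always has a witness:\<close>

lemma digraph_iso_relabel:
  assumes "simple_graph G" "inj_on h (pverts G)"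
  shows "digraph_iso (with_proj G) (with_proj (relabel h G))" "simple_graph (relabel h G)"
proof -
  interpret pair_graph G using assms by (simp add: simple_graph_def)
  let ?iso = "\<lparr> iso_verts = h, iso_arcs = map_prod h h, iso_head = snd, iso_tail = fst \<rparr>"
  have arcs: "parcs G \<subseteq> pverts G \<times> pverts G"
    using in_arcsD1 in_arcsD2 by auto
  have "inj_on (map_prod h h) (parcs G)"
    using map_prod_inj_on[OF assms(2) assms(2)] arcs by (rule inj_on_subset)
  then have "digraph_isomorphism ?iso"
    using assms(2) wf_digraph by (auto simp: digraph_isomorphism_def)
  then show "digraph_iso (with_proj G) (with_proj (relabel h G))"
    unfolding digraph_iso_def
    by (intro exI[of _ ?iso]) (auto simp: app_iso_def with_proj_def relabel_def)
  have sym: "(v, u) \<in> parcs G" if "(u, v) \<in> parcs G" for u v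
    using that sym_arcs by (auto simp: symmetric_def dest: symD)
  have "pair_graph (relabel h G)"
  proof unfold_locales
    fix e assume "e \<in> parcs (relabel h G)"
    then obtain u v where uv: "e = (h u, h v)" "(u, v) \<in> parcs G"
      by (auto simp: relabel_def)
    then show "fst e \<in> pverts (relabel h G)" "snd e \<in> pverts (relabel h G)"
      using arcs by (auto simp: relabel_def)
    show "fst e \<noteq> snd e"
      using uv arcs assms(2) pair_no_loops[OF uv(2)] by (auto dest: inj_onD)
  next
    show "finite (pverts (relabel h G))" "finite (parcs (relabel h G))"
      using pair_finite_verts pair_finite_arcs by (auto simp: relabel_def)
    show "symmetric (with_proj (relabel h G))"
      by (force simp: symmetric_def relabel_def intro!: symI dest: sym)
  qed
  then show "simple_graph (relabel h G)"
    using assms(1) by (auto simp: simple_graph_def relabel_def)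
qed

lemma inv_value_eq:
  assumes "graph_invariant f" "simple_graph G"
    and "simple_graph H" "digraph_iso (with_proj G) (with_proj H)"
  shows "inv_value f G = f H"
proof -
  let ?P = "\<lambda>H :: nat pair_pre_digraph. simple_graph H \<and> digraph_iso (with_proj G) (with_proj H)"
  have S: "?P (SOME H. ?P H)" by (rule someI[of ?P H]) (use assms in simp)
  interpret pair_graph G using assms(2) by (simp add: simple_graph_def)
  have "digraph_iso (with_proj (SOME H. ?P H)) (with_proj G)"
    by (rule digraph_iso_swap[OF wf_digraph]) (use S in simp)
  then have "digraph_iso (with_proj (SOME H. ?P H)) (with_proj H)"
    using assms(4) by (rule digraph_iso_trans)
  then show ?thesis
    using S assms(1,3) unfolding graph_invariant_def inv_value_def by blast
qed

lemma inv_value_witness: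
  assumes "simple_graph G"
  shows "\<exists>H :: nat pair_pre_digraph. simple_graph H \<and> digraph_iso (with_proj G) (with_proj H)"
proof -
  have "finite (pverts G)"
    using assms pair_fin_digraph.pair_finite_verts
    by (auto simp: simple_graph_def pair_graph_def pair_digraph_def)
  then obtain h :: "_ \<Rightarrow> nat" where "inj_on h (pverts G)"
    using finite_imp_inj_to_nat_seg by blast
  then show ?thesis using digraph_iso_relabel[OF assms] by blast
qed

end

theory Submission
  imports Defs
begin

text \<open>
  Write \<open>A\<close> for the complement of \<open>G\<close>. An admissible invariant \<open>f\<close> takes a value of at least
  \<open>m\<close> on the complete graph with \<open>m\<close> vertices (\<open>clique_class_ge\<close>: compare powers of \<open>m\<close> with
  powers of \<open>2\<close>), so a clique of size \<open>\<omega>\<close> in the \<open>n\<close>-th power of \<open>A\<close> gives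
  \<open>f(A)\<^sup>n \<ge> \<omega>\<close>. Hence every \<open>f(A)\<close> is an upper bound of the Shannon capacity. It remains to find one
  admissible invariant for which this bound is attained; the infimum is in fact a minimum.

  Admissible invariants are, after taking binary logarithms, the monotone homomorphisms from an ordered
  commutative monoid to the additive group of the reals that send a fixed element \<open>u\<close> to \<open>1\<close>: identify two
  graphs when there are graph maps in both directions, let \<open>\<le>\<close> be existence of a graph map, let
  the multiplication be the disjunctive product, and let \<open>u\<close> be the class of the complete graph on two
  vertices. In this monoid every element lies between \<open>1\<close> and a power of \<open>u\<close>, and for such monoids a
  Hahn-Banach argument works. Consider the subadditive, monotone and homogeneous functionals \<open>q\<close> with
  \<open>q(x u) = q(x) + 1\<close>. By Zorn's lemma there is a minimal one below any given one, and a minimal one is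
  additive, because it cannot be lowered by replacing \<open>q(x)\<close> with the infimum over \<open>k\<close> of
  \<open>q(x a\<^sup>k) - k q(a)\<close> (\<open>rate_functional_relax\<close>, \<open>minimal_rate_additive\<close>).

  Suppose that the capacity is \<open>2\<^sup>t\<close>. The starting functional is the cheapest asymptotic price of \<open>x\<close>
  when \<open>u\<close> costs \<open>1\<close> and \<open>A\<close> costs \<open>t\<close> (\<open>rate_functional_exchange\<close>). It satisfies
  \<open>q(A) \<le> t\<close>, and all that could go wrong is that prices become negative, that is, that copies of \<open>A\<close>
  together with some copies of \<open>u\<close> yield too many copies of \<open>u\<close>. The copies of \<open>u\<close> on the side of \<open>A\<close>
  do not help, since complete graphs can be cancelled by the pigeonhole principle (\<open>complete_cancel\<close>),
  and without them the clique numbers of the powers of \<open>A\<close> are bounded by the powers of \<open>2\<^sup>t\<close>.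

  The limit that defines the capacity exists since the logarithms of these clique numbers are superadditive
  (\<open>superadditive_limit\<close>).
\<close>

section \<open>Additive functionals on ordered commutative monoids\<close>

class ordered_comm_monoid_mult = comm_monoid_mult + order +
  assumes mult_le_left: "a \<le> b \<Longrightarrow> c * a \<le> c * b"
begin

lemma mult_le_mono: "a \<le> b \<Longrightarrow> c \<le> d \<Longrightarrow> a * c \<le> b * d"
  by (metis mult_le_left mult.commute order_trans)

lemma power_le_mono: "a \<le> b \<Longrightarrow> a ^ n \<le> b ^ n"
  by (induction n) (simp_all add: mult_le_mono)

end

locale bounded_monoid =
  fixes u :: "'m :: ordered_comm_monoid_mult"
  assumes one_le: "1 \<le> x"
    and bounded: "\<exists>n. x \<le> u ^ n"
begin

text \<open>
  These play the role of the sublinear functionals in the Hahn-Banach theorem. The last condition makes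
  them additive in the direction of the order unit \<open>u\<close> and fixes the normalisation.
\<close>
definition rate_functional :: "('m \<Rightarrow> real) \<Rightarrow> bool" where
  "rate_functional q \<longleftrightarrow>
     (\<forall>x y. q (x * y) \<le> q x + q y) \<and> (\<forall>x y. x \<le> y \<longrightarrow> q x \<le> q y) \<and>
     (\<forall>x n. q (x ^ n) = real n * q x) \<and> (\<forall>x. q (x * u) = q x + 1)"

text \<open>
  Subadditivity supplies one half of each of the two equations, so only inequalities that pass to infima
  remain to be checked.
\<close>
lemma rate_functionalI:
  assumes "q 1 \<le> 0" "q u \<le> 1"
    and sub: "\<And>x y. q (x * y) \<le> q x + q y"
    and "\<And>x y. x \<le> y \<Longrightarrow> q x \<le> q y"
    and pow: "\<And>x n. n > 0 \<Longrightarrow> real n * q x \<le> q (x ^ n)"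
    and "\<And>x. q x + 1 \<le> q (x * u)"
  shows "rate_functional q"
proof -
  have "q 1 = 0"
    using sub[of 1 1] assms(1) by simp
  then have "q (x ^ n) \<le> real n * q x" for x n
  proof (induction n)
    case (Suc n)
    then show ?case using sub[of x "x ^ n"] by (simp add: algebra_simps)
  qed simp
  moreover have "real n * q x \<le> q (x ^ n)" for x n
    using pow[of n x] \<open>q 1 = 0\<close> by (cases n) auto
  moreover have "q (x * u) \<le> q x + 1" for x
    using sub[of x u] assms(2) by simp
  ultimately show ?thesis
    unfolding rate_functional_def using assms by (metis antisym)
qed

context
  fixes q assumes q: "rate_functional q"
begin

lemma rate_mult: "q (x * y) \<le> q x + q y"
  and rate_mono: "x \<le> y \<Longrightarrow> q x \<le> q y"
  and rate_power: "q (x ^ n) = real n * q x"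
  and rate_shift: "q (x * u) = q x + 1"
  using q by (auto simp: rate_functional_def)

lemma rate_one: "q 1 = 0"
  using rate_power[of 1 0] by simp

lemma rate_unit: "q u = 1"
  using rate_shift[of 1] rate_one by simp

lemma rate_nonneg: "0 \<le> q x"
  using rate_mono[OF one_le[of x]] rate_one by simp

end

lemma chain_inf_rate:
  assumes C: "C \<noteq> {}" "\<And>p. p \<in> C \<Longrightarrow> rate_functional p"
    and chain: "\<And>p p'. p \<in> C \<Longrightarrow> p' \<in> C \<Longrightarrow> p \<le> p' \<or> p' \<le> p"
  shows "rate_functional (\<lambda>x. INF p\<in>C. p x)"
proof -
  define q where "q = (\<lambda>x. INF p\<in>C. p x)"
  have lower: "q x \<le> p x" if "p \<in> C" for p x
    unfolding q_def using that rate_nonneg[OF C(2)] by (auto intro!: cINF_lower bdd_belowI2[where m = 0])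
  have greatest: "c \<le> q x" if "\<And>p. p \<in> C \<Longrightarrow> c \<le> p x" for c x
    unfolding q_def using that C(1) by (intro cINF_greatest) auto
  obtain p0 where p0: "p0 \<in> C" using C(1) by blast
  have "rate_functional q"
  proof (rule rate_functionalI)
    show "q 1 \<le> 0" using lower[OF p0] rate_one[OF C(2)[OF p0]] by metis
    show "q u \<le> 1" using lower[OF p0] rate_unit[OF C(2)[OF p0]] by metis
    show "q x \<le> q y" if "x \<le> y" for x y
    proof (rule greatest)
      show "q x \<le> p y" if "p \<in> C" for p
        using lower[OF that, of x] rate_mono[OF C(2)[OF that] \<open>x \<le> y\<close>] by simp
    qed
    show "q x + 1 \<le> q (x * u)" for x
    proof (rule greatest)
      show "q x + 1 \<le> p (x * u)" if "p \<in> C" for p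
        using lower[OF that, of x] rate_shift[OF C(2)[OF that], of x] by simp
    qed
    show "real n * q x \<le> q (x ^ n)" for x n
    proof (rule greatest)
      show "real n * q x \<le> p (x ^ n)" if "p \<in> C" for p
        using lower[OF that, of x] rate_power[OF C(2)[OF that], of x] by (simp add: mult_left_mono)
    qed
    show "q (x * y) \<le> q x + q y" for x y
    proof -
      have *: "q (x * y) \<le> p x + p' y" if pp: "p \<in> C" "p' \<in> C" for p p'
      proof -
        \<comment> \<open>of two members of the chain the smaller one witnesses the inequality for both\<close>
        obtain r where r: "r \<in> C" "r \<le> p" "r \<le> p'"
          using chain[OF pp] pp by blast
        have "q (x * y) \<le> r x + r y"
          using lower[OF r(1), of "x * y"] rate_mult[OF C(2)[OF r(1)], of x y] by simp
        then show ?thesis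
          using r(2,3) by (meson add_mono le_funD order_trans)
      qed
      have "q (x * y) - p x \<le> q y" if "p \<in> C" for p
        by (rule greatest) (use *[OF that] in \<open>simp add: algebra_simps\<close>)
      then have "q (x * y) - q y \<le> q x"
        by (intro greatest) (simp add: algebra_simps)
      then show ?thesis by simp
    qed
  qed
  then show ?thesis by (simp add: q_def)
qed

lemma minimal_rate_functional:
  assumes "rate_functional q0"
  obtains q where "rate_functional q" "q \<le> q0"
    "\<And>q'. rate_functional q' \<Longrightarrow> q' \<le> q \<Longrightarrow> q' = q"
proof -
  define A where "A = {q. rate_functional q \<and> q \<le> q0}"
  have "\<exists>m\<in>A. \<forall>a\<in>A. a \<le> m \<longrightarrow> a = m"
  proof (rule predicate_Zorn)
    show "partial_order_on A (relation_of (\<lambda>x y. y \<le> x) A)"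
      by (rule partial_order_on_relation_ofI) auto
    fix C assume C: "C \<in> Chains (relation_of (\<lambda>x y. y \<le> x) A)"
    then have CA: "C \<subseteq> A"
      by (auto simp: Chains_def relation_of_def)
    show "\<exists>m\<in>A. \<forall>a\<in>C. m \<le> a"
    proof (cases "C = {}")
      case True
      then show ?thesis using assms by (auto simp: A_def)
    next
      case False
      define m where "m = (\<lambda>x. INF p\<in>C. p x)"
      have rate: "rate_functional m"
        unfolding m_def using False
        by (rule chain_inf_rate) (use C CA in \<open>auto simp: Chains_def relation_of_def A_def\<close>)
      have lower: "m \<le> p" if "p \<in> C" for p
        unfolding m_def le_fun_def using that rate_nonneg CA
        by (force intro!: cINF_lower bdd_belowI2[where m = 0] simp: A_def)
      obtain p where "p \<in> C" using False by blast
      then have "m \<le> q0" using lower[of p] CA by (auto simp: A_def)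
      then show ?thesis using rate lower by (auto simp: A_def)
    qed
  qed
  then show ?thesis
    using that unfolding A_def by (smt (verit) mem_Collect_eq order_trans)
qed

text \<open>
  The Hahn-Banach step. The new functional is the largest one below \<open>q\<close> that satisfies
  \<open>q' (x * a) = q' x + q a\<close> for all \<open>x\<close>. By subadditivity the terms of the infimum decrease with \<open>k\<close>, and monotonicity together
  with homogeneity bounds them below by \<open>0\<close>.
\<close>
lemma rate_functional_relax:
  fixes a :: 'm
  assumes q: "rate_functional q"
  defines "q' \<equiv> \<lambda>x. INF k. q (x * a ^ k) - real k * q a"
  shows "rate_functional q'" "q' x \<le> q (x * a) - q a" "q' \<le> q"
proof -
  note mult = rate_mult[OF q] and mono = rate_mono[OF q] and power = rate_power[OF q]
    and shift = rate_shift[OF q]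
  have nonneg: "0 \<le> q (x * a ^ k) - real k * q a" for x k
    using mono[of "a ^ k" "x * a ^ k"] mult_le_mono[OF one_le[of x] order_refl[of "a ^ k"]] power[of a k]
    by simp
  have lower: "q' x \<le> q (x * a ^ k) - real k * q a" for x k
    unfolding q'_def using nonneg by (intro cINF_lower bdd_belowI2[where m = 0]) auto
  have greatest: "c \<le> q' x" if "\<And>k. c \<le> q (x * a ^ k) - real k * q a" for c x
    unfolding q'_def using that by (intro cINF_greatest) auto
  show "q' x \<le> q (x * a) - q a"
    using lower[of x 1] by simp
  show le: "q' \<le> q"
    unfolding le_fun_def using lower[of _ 0] by simp
  show "rate_functional q'"
  proof (rule rate_functionalI)
    show "q' 1 \<le> 0" using le rate_one[OF q] by (metis le_funD)
    show "q' u \<le> 1" using le rate_unit[OF q] by (metis le_funD)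
    show "q' x \<le> q' y" if "x \<le> y" for x y
    proof (rule greatest)
      show "q' x \<le> q (y * a ^ k) - real k * q a" for k
        using lower[of x k] mono[of "x * a ^ k" "y * a ^ k"] mult_le_mono[OF that order_refl] by simp
    qed
    show "q' x + 1 \<le> q' (x * u)" for x
    proof (rule greatest)
      show "q' x + 1 \<le> q (x * u * a ^ k) - real k * q a" for k
        using lower[of x k] shift[of "x * a ^ k"] by (simp add: ac_simps)
    qed
    show "q' (x * y) \<le> q' x + q' y" for x y
    proof -
      have *: "q' (x * y) \<le> (q (x * a ^ k) - real k * q a) + (q (y * a ^ l) - real l * q a)" for k l
        using lower[of "x * y" "k + l"] mult[of "x * a ^ k" "y * a ^ l"]
        by (simp add: power_add ac_simps algebra_simps)
      have "q' (x * y) - (q (x * a ^ k) - real k * q a) \<le> q' y" for k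
        by (rule greatest) (use *[of k] in \<open>simp add: algebra_simps\<close>)
      then have "q' (x * y) - q' y \<le> q' x"
        by (intro greatest) (simp add: algebra_simps)
      then show ?thesis by simp
    qed
    show "real n * q' x \<le> q' (x ^ n)" if "n > 0" for x n
    proof (rule greatest)
      fix k
      \<comment> \<open>the terms of the infimum decrease with \<open>k\<close>, so the multiples of \<open>n\<close> suffice\<close>
      define l where "l = k * n - k"
      have l: "k * n = k + l"
        using that by (simp add: l_def)
      have "real n * q' x \<le> real n * (q (x * a ^ k) - real k * q a)"
        using lower[of x k] by (simp add: mult_left_mono)
      also have "\<dots> = q (x ^ n * a ^ (k + l)) - real (k * n) * q a"
        using power[of "x * a ^ k" n]
        by (simp add: l[symmetric] power_mult power_mult_distrib algebra_simps)
      also have "\<dots> \<le> q (x ^ n * a ^ k) - real k * q a"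
        using mult[of "x ^ n * a ^ k" "a ^ l"] power[of a l]
        by (simp add: l power_add algebra_simps)
      finally show "real n * q' x \<le> q (x ^ n * a ^ k) - real k * q a" .
    qed
  qed
qed

lemma minimal_rate_additive:
  assumes q: "rate_functional q"
    and minimal: "\<And>q'. rate_functional q' \<Longrightarrow> q' \<le> q \<Longrightarrow> q' = q"
  shows "q (x * y) = q x + q y"
proof -
  have "q x \<le> q (x * y) - q y"
    using fun_cong[OF minimal[OF rate_functional_relax(1,3)[OF q, where a = y]], of x] rate_functional_relax(2)[OF q, where x = x and a = y]
    by simp
  then show ?thesis using rate_mult[OF q, of x y] by simp
qed

text \<open>
  Prices per copy of \<open>x\<close> when \<open>a\<close> costs \<open>t\<close> and \<open>u\<close> costs \<open>1\<close>. The copies of \<open>u\<close> that are returned on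
  the left-hand side are refunded. Allowing them makes the infimum of the prices satisfy
  \<open>q(x u) = q(x) + 1\<close> although the monoid need not be cancellative.
\<close>
definition exchange_rates :: "'m \<Rightarrow> real \<Rightarrow> 'm \<Rightarrow> real set" where
  "exchange_rates a t x =
     {(real m' - real m + real j * t) / real n | n m m' j. n > 0 \<and> x ^ n * u ^ m \<le> a ^ j * u ^ m'}"

text \<open>
  The hypothesis says that no exchange creates copies of \<open>u\<close> below cost. As every element is at
  least \<open>1\<close>, this keeps all prices nonnegative, so that their infimum is meaningful.
\<close>
lemma rate_functional_exchange:
  fixes a :: 'm
  assumes t: "\<And>m m' j. u ^ m \<le> a ^ j * u ^ m' \<Longrightarrow> real m \<le> real m' + real j * t"
  defines "q \<equiv> \<lambda>x. Inf (exchange_rates a t x)"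
  shows "rate_functional q" "q a \<le> t"
proof -
  have nonneg: "0 \<le> (real m' - real m + real j * t) / real n"
    if "x ^ n * u ^ m \<le> a ^ j * u ^ m'" for x n m m' j
  proof -
    have "u ^ m \<le> x ^ n * u ^ m"
      using mult_le_mono[OF one_le order_refl] by (metis mult_1)
    then show ?thesis
      using t[of m j m'] that by (simp add: order_trans)
  qed
  have lower: "q x \<le> (real m' - real m + real j * t) / real n"
    if "n > 0" "x ^ n * u ^ m \<le> a ^ j * u ^ m'" for x n m m' j
    unfolding q_def
  proof (rule cInf_lower)
    show "bdd_below (exchange_rates a t x)"
      using nonneg by (intro bdd_belowI[where m = 0]) (auto simp: exchange_rates_def)
  qed (use that in \<open>auto simp: exchange_rates_def\<close>)
  have greatest: "c \<le> q x"
    if "\<And>n m m' j. n > 0 \<Longrightarrow> x ^ n * u ^ m \<le> a ^ j * u ^ m' \<Longrightarrow>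
          c \<le> (real m' - real m + real j * t) / real n" for c x
    unfolding q_def
  proof (rule cInf_greatest)
    obtain k where "x \<le> u ^ k" using bounded by blast
    then have "x ^ 1 * u ^ 0 \<le> a ^ 0 * u ^ k" by simp
    then show "exchange_rates a t x \<noteq> {}"
      unfolding exchange_rates_def by blast
  qed (use that in \<open>auto simp: exchange_rates_def\<close>)
  show "q a \<le> t"
    using lower[of 1 a 0 1 0] by simp
  show "rate_functional q"
  proof (rule rate_functionalI)
    show "q 1 \<le> 0" using lower[of 1 1 0 0 0] by simp
    show "q u \<le> 1" using lower[of 1 u 0 0 1] by simp
    show "q x \<le> q y" if "x \<le> y" for x y
    proof (rule greatest)
      fix n m m' j assume n: "(n::nat) > 0" and "y ^ n * u ^ m \<le> a ^ j * u ^ m'"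
      then have "x ^ n * u ^ m \<le> a ^ j * u ^ m'"
        using mult_le_mono[OF power_le_mono[OF that, of n] order_refl[of "u ^ m"]] order_trans by blast
      with n show "q x \<le> (real m' - real m + real j * t) / real n" by (rule lower)
    qed
    show "q x + 1 \<le> q (x * u)" for x
    proof (rule greatest)
      fix n m m' j assume n: "(n::nat) > 0" and *: "(x * u) ^ n * u ^ m \<le> a ^ j * u ^ m'"
      then have "x ^ n * u ^ (n + m) \<le> a ^ j * u ^ m'"
        by (simp add: power_mult_distrib power_add ac_simps)
      from lower[OF n this] show "q x + 1 \<le> (real m' - real m + real j * t) / real n"
        using n by (simp add: field_simps)
    qed
    show "real k * q x \<le> q (x ^ k)" if "k > 0" for x k
    proof (rule greatest)
      fix n m m' j assume n: "(n::nat) > 0" and "(x ^ k) ^ n * u ^ m \<le> a ^ j * u ^ m'"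
      then have "x ^ (k * n) * u ^ m \<le> a ^ j * u ^ m'"
        by (simp add: power_mult)
      from lower[OF _ this] show "real k * q x \<le> (real m' - real m + real j * t) / real n"
        using n that by (simp add: field_simps)
    qed
    show "q (x * y) \<le> q x + q y" for x y
    proof -
      have *: "q (x * y) \<le> (real m' - real m + real j * t) / real n + (real l' - real l + real i * t) / real k"
        if n: "n > 0" and x: "x ^ n * u ^ m \<le> a ^ j * u ^ m'"
          and k: "k > 0" and y: "y ^ k * u ^ l \<le> a ^ i * u ^ l'" for n m m' j k l l' i
      proof -
        have "(x * y) ^ (n * k) * u ^ (m * k + l * n) = (x ^ n * u ^ m) ^ k * (y ^ k * u ^ l) ^ n"
          by (simp add: power_mult_distrib power_add flip: power_mult) (simp add: ac_simps)
        also have "\<dots> \<le> (a ^ j * u ^ m') ^ k * (a ^ i * u ^ l') ^ n"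
          by (intro mult_le_mono power_le_mono x y)
        also have "\<dots> = a ^ (j * k + i * n) * u ^ (m' * k + l' * n)"
          by (simp add: power_mult_distrib power_add flip: power_mult) (simp add: ac_simps)
        finally have "q (x * y) \<le>
            (real (m' * k + l' * n) - real (m * k + l * n) + real (j * k + i * n) * t) / real (n * k)"
          using n k by (intro lower) auto
        also have "\<dots> = (real m' - real m + real j * t) / real n + (real l' - real l + real i * t) / real k"
          using n k by (simp add: field_simps)
        finally show ?thesis .
      qed
      have "q (x * y) - (real m' - real m + real j * t) / real n \<le> q y"
        if "n > 0" "x ^ n * u ^ m \<le> a ^ j * u ^ m'" for n m m' j
        by (rule greatest) (use *[OF that] in \<open>simp add: algebra_simps\<close>)
      then have "q (x * y) - q y \<le> q x"
        by (intro greatest) (simp add: algebra_simps)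
      then show ?thesis by simp
    qed
  qed
qed

theorem additive_rate_exists:
  assumes "\<And>m m' j. u ^ m \<le> a ^ j * u ^ m' \<Longrightarrow> real m \<le> real m' + real j * t"
  obtains \<phi> :: "'m \<Rightarrow> real" where
    "\<And>x y. \<phi> (x * y) = \<phi> x + \<phi> y" "\<And>x y. x \<le> y \<Longrightarrow> \<phi> x \<le> \<phi> y" "\<phi> u = 1" "\<phi> a \<le> t"
proof -
  let ?q0 = "\<lambda>x. Inf (exchange_rates a t x)"
  note exchange = rate_functional_exchange[where a = a and t = t, OF assms]
  obtain q where q: "rate_functional q" "q \<le> ?q0"
    "\<And>q'. rate_functional q' \<Longrightarrow> q' \<le> q \<Longrightarrow> q' = q"
    using minimal_rate_functional[OF exchange(1)] by blast
  have "q a \<le> t"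
    using le_funD[OF q(2), of a] exchange(2) by simp
  then show ?thesis
    using that[of q] minimal_rate_additive[OF q(1,3)] rate_mono[OF q(1)] rate_unit[OF q(1)] by blast
qed

end

section \<open>The preorder of graphs under graph maps\<close>

lemma simple_graph_iff:
  "simple_graph G \<longleftrightarrow> finite (pverts G) \<and> pverts G \<noteq> {} \<and> parcs G \<subseteq> pverts G \<times> pverts G \<and>
     (\<forall>u v. (u, v) \<in> parcs G \<longrightarrow> (v, u) \<in> parcs G) \<and> (\<forall>v. (v, v) \<notin> parcs G)"
    (is "_ \<longleftrightarrow> ?R")
proof
  assume "simple_graph G"
  then interpret pair_graph G by (simp add: simple_graph_def)
  have "(v, v) \<notin> parcs G" for v
    using pair_no_loops[of "(v, v)"] by auto
  then show ?R
    using \<open>simple_graph G\<close> pair_finite_verts in_arcsD1 in_arcsD2 sym_arcs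
    by (auto simp: simple_graph_def symmetric_def dest: symD)
next
  assume R: ?R
  then have "finite (parcs G)"
    by (meson finite_SigmaI finite_subset)
  moreover have "symmetric (with_proj G)"
    using R by (auto simp: symmetric_def intro: symI)
  ultimately have "pair_graph G"
    using R by unfold_locales auto
  then show "simple_graph G"
    using R by (simp add: simple_graph_def)
qed

lemma simple_graph_arcD:
  assumes "simple_graph G" "(u, v) \<in> parcs G"
  shows "u \<in> pverts G" "v \<in> pverts G" "u \<noteq> v" "(v, u) \<in> parcs G"
  using assms unfolding simple_graph_iff by blast+

definition graph_le :: "'a pair_pre_digraph \<Rightarrow> 'b pair_pre_digraph \<Rightarrow> bool" (infix \<open>\<preceq>\<close> 50) where
  "G \<preceq> H \<longleftrightarrow> (\<exists>\<phi>. graph_map \<phi> G H)"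

lemma graph_leI:
  assumes "\<And>v. v \<in> pverts G \<Longrightarrow> \<phi> v \<in> pverts H"
    and "\<And>u v. (u, v) \<in> parcs G \<Longrightarrow> (\<phi> u, \<phi> v) \<in> parcs H"
  shows "G \<preceq> H"
  using assms unfolding graph_le_def graph_map_def by blast

lemma graph_le_refl: "G \<preceq> G"
  by (rule graph_leI[where \<phi> = id]) auto

lemma graph_le_trans:
  assumes "G \<preceq> H" "H \<preceq> J"
  shows "G \<preceq> J"
proof -
  obtain \<phi> \<psi> where "graph_map \<phi> G H" "graph_map \<psi> H J"
    using assms by (auto simp: graph_le_def)
  then show ?thesis
    by (intro graph_leI[where \<phi> = "\<psi> \<circ> \<phi>"]) (auto simp: graph_map_def)
qed

lemma digraph_iso_imp_graph_le:
  assumes "digraph_iso (with_proj G) (with_proj H)"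
  shows "G \<preceq> H"
proof -
  obtain f where f: "pre_digraph.digraph_isomorphism (with_proj G) f" "with_proj H = app_iso f (with_proj G)"
    using assms unfolding digraph_iso_def by blast
  have "verts (with_proj H) = iso_verts f ` pverts G" "arcs_ends (with_proj H) = (\<lambda>(u, v). (iso_verts f u, iso_verts f v)) ` parcs G"
    using f(2) wf_digraph.arcs_ends_app_iso_eq[OF _ f(1)] f(1)
    by (simp_all add: pre_digraph.digraph_isomorphism_def)
  then show ?thesis
    by (intro graph_leI[where \<phi> = "iso_verts f"]) auto
qed

lemma relabel_graph_le:
  assumes "simple_graph G" "inj_on h (pverts G)"
  shows "G \<preceq> relabel h G" "relabel h G \<preceq> G"
proof -
  interpret pair_graph G using assms by (simp add: simple_graph_def)
  show "G \<preceq> relabel h G" "relabel h G \<preceq> G"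
    using digraph_iso_relabel(1)[OF assms] digraph_iso_swap[OF wf_digraph]
    by (auto intro: digraph_iso_imp_graph_le)
qed

lemma simple_graph_complement: "simple_graph G \<Longrightarrow> simple_graph (complement_graph G)"
  by (auto simp: simple_graph_iff complement_graph_def)

lemma simple_graph_disj_prod:
  "simple_graph G \<Longrightarrow> simple_graph H \<Longrightarrow> simple_graph (disj_prod G H)"
  by (auto simp: simple_graph_iff disj_prod_def)

lemma inj_on_Cons: "inj_on (\<lambda>(v, vs). v # vs) A"
  by (auto simp: inj_on_def)

lemma simple_graph_disj_power: "simple_graph G \<Longrightarrow> simple_graph (disj_power G n)"
proof (induction n)
  case 0
  then show ?case by (auto simp: simple_graph_iff)
next
  case (Suc n)
  then show ?case
    using digraph_iso_relabel(2)[OF simple_graph_disj_prod inj_on_Cons] by simp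
qed

lemma disj_prod_mono:
  assumes "G \<preceq> G'" "H \<preceq> H'"
  shows "disj_prod G H \<preceq> disj_prod G' H'"
proof -
  obtain \<phi> \<psi> where "graph_map \<phi> G G'" "graph_map \<psi> H H'"
    using assms by (auto simp: graph_le_def)
  then show ?thesis
    by (intro graph_leI[where \<phi> = "map_prod \<phi> \<psi>"]) (auto simp: disj_prod_def graph_map_def)
qed

lemma disj_prod_commute: "disj_prod G H \<preceq> disj_prod H G"
  by (rule graph_leI[where \<phi> = prod.swap]) (auto simp: disj_prod_def)

lemma disj_prod_assoc:
  "disj_prod (disj_prod G H) J \<preceq> disj_prod G (disj_prod H J)"
  "disj_prod G (disj_prod H J) \<preceq> disj_prod (disj_prod G H) J"
   by (rule graph_leI[where \<phi> = "\<lambda>((a, b), c). (a, b, c)"]; auto simp: disj_prod_def)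
     (rule graph_leI[where \<phi> = "\<lambda>(a, b, c). ((a, b), c)"]; auto simp: disj_prod_def)

definition complete_graph :: "nat \<Rightarrow> nat pair_pre_digraph" where
  "complete_graph n = \<lparr> pverts = {..<n}, parcs = {(i, j). i < n \<and> j < n \<and> i \<noteq> j} \<rparr>"

lemma simple_graph_complete: "n > 0 \<Longrightarrow> simple_graph (complete_graph n)"
  by (auto simp: simple_graph_iff complete_graph_def)

lemma complete_graph_leI:
  assumes "simple_graph G" "inj_on g (pverts G)" "g ` pverts G \<subseteq> {..<n}"
  shows "G \<preceq> complete_graph n"
proof (rule graph_leI[where \<phi> = g])
  show "(g u, g v) \<in> parcs (complete_graph n)" if "(u, v) \<in> parcs G" for u v
  proof -
    have "u \<in> pverts G" "v \<in> pverts G" "u \<noteq> v"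
      using simple_graph_arcD[OF assms(1) that] by auto
    then show ?thesis
      using inj_onD[OF assms(2), of u v] assms(3) by (auto simp: complete_graph_def)
  qed
qed (use assms(3) in \<open>auto simp: complete_graph_def\<close>)

lemma graph_le_complete_card:
  assumes "simple_graph G"
  shows "G \<preceq> complete_graph (card (pverts G))"
proof -
  obtain g where "bij_betw g (pverts G) {..<card (pverts G)}"
    using assms ex_bij_betw_finite_nat[of "pverts G"]
    by (auto simp: simple_graph_iff atLeast0LessThan)
  then show ?thesis
    using assms by (intro complete_graph_leI[where g = g]) (auto simp: bij_betw_def)
qed

lemma complete_mono: "m \<le> n \<Longrightarrow> complete_graph m \<preceq> complete_graph n"
  by (rule graph_leI[where \<phi> = id]) (auto simp: complete_graph_def)

lemma complete_one_le: "simple_graph G \<Longrightarrow> complete_graph 1 \<preceq> G"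
  by (rule graph_leI[where \<phi> = "\<lambda>_. SOME v. v \<in> pverts G"])
    (auto simp: complete_graph_def simple_graph_iff some_in_eq)

lemma disj_prod_one:
  assumes "simple_graph G"
  shows "disj_prod (complete_graph 1) G \<preceq> G" "G \<preceq> disj_prod (complete_graph 1) G"
  by (rule graph_leI[where \<phi> = snd]; auto simp: disj_prod_def complete_graph_def)
     (rule graph_leI[where \<phi> = "Pair 0"];
      use simple_graph_arcD[OF assms] in \<open>auto simp: disj_prod_def complete_graph_def\<close>)

lemma clique_inj_on:
  assumes "graph_map \<phi> (complete_graph n) G" "simple_graph G"
  shows "inj_on \<phi> {..<n}"
proof (rule inj_onI, rule ccontr)
  fix i j assume "i \<in> {..<n}" "j \<in> {..<n}" "\<phi> i = \<phi> j" "i \<noteq> j"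
  then have "(\<phi> i, \<phi> i) \<in> parcs G"
    using assms(1) unfolding graph_map_def complete_graph_def by force
  then show False
    using simple_graph_arcD(3)[OF assms(2)] by blast
qed

lemma clique_imp_complete_graph_le:
  assumes "inj_on \<phi> {..<n}" "\<phi> ` {..<n} \<subseteq> V"
    and "\<And>u v. u \<in> V \<Longrightarrow> v \<in> V \<Longrightarrow> u \<noteq> v \<Longrightarrow> (u, v) \<in> parcs G" "V \<subseteq> pverts G"
  shows "complete_graph n \<preceq> G"
proof (rule graph_leI[where \<phi> = \<phi>])
  show "(\<phi> i, \<phi> j) \<in> parcs G" if "(i, j) \<in> parcs (complete_graph n)" for i j
    using that assms(2) inj_onD[OF assms(1), of i j] by (intro assms(3)) (auto simp: complete_graph_def)
qed (use assms(2,4) in \<open>auto simp: complete_graph_def\<close>)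

lemma disj_prod_complete:
  shows "disj_prod (complete_graph m) (complete_graph n) \<preceq> complete_graph (m * n)"
    and "complete_graph (m * n) \<preceq> disj_prod (complete_graph m) (complete_graph n)"
proof -
  have card: "card ({..<m} \<times> {..<n}) = m * n" by simp
  obtain g where g: "bij_betw g ({..<m} \<times> {..<n}) {..<m * n}"
    using ex_bij_betw_finite_nat[of "{..<m} \<times> {..<n}"] by (auto simp: atLeast0LessThan)
  show "disj_prod (complete_graph m) (complete_graph n) \<preceq> complete_graph (m * n)"
    by (rule graph_leI[where \<phi> = g])
      (use g in \<open>auto simp: disj_prod_def complete_graph_def bij_betw_def inj_on_def\<close>)
  show "complete_graph (m * n) \<preceq> disj_prod (complete_graph m) (complete_graph n)"
    using bij_betw_inv_into[OF g]
    by (intro clique_imp_complete_graph_le[where \<phi> = "inv_into ({..<m} \<times> {..<n}) g" and V = "{..<m} \<times> {..<n}"])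
      (auto simp: bij_betw_def disj_prod_def complete_graph_def)
qed

text \<open>
  Pigeonhole: some \<open>p\<close> of the \<open>p * r\<close> clique vertices share their second coordinate. They are not
  adjacent in the second factor, so their first coordinates form a clique.
\<close>
lemma complete_cancel:
  assumes G: "simple_graph G" and r: "r > 0"
    and le: "complete_graph (p * r) \<preceq> disj_prod G (complete_graph r)"
  shows "complete_graph p \<preceq> G"
proof -
  obtain \<phi> where \<phi>: "graph_map \<phi> (complete_graph (p * r)) (disj_prod G (complete_graph r))"
    using le by (auto simp: graph_le_def)
  define fib where "fib c = {i \<in> {..<p * r}. snd (\<phi> i) = c}" for c
  have "snd (\<phi> i) < r" if "i < p * r" for i
  proof -
    have "\<phi> i \<in> pverts G \<times> {..<r}"
      using \<phi> that by (simp add: graph_map_def complete_graph_def disj_prod_def)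
    then show ?thesis by auto
  qed
  then have "(\<Union>c<r. fib c) = {..<p * r}"
    by (auto simp: fib_def)
  then have "p * r \<le> (\<Sum>c<r. card (fib c))"
    using card_UN_le[of "{..<r}" fib] by simp
  moreover have "(\<Sum>c<r. card (fib c)) < r * p" if "\<forall>c<r. card (fib c) < p"
    using sum_strict_mono[of "{..<r}" "\<lambda>c. card (fib c)" "\<lambda>_. p"] that r by auto
  ultimately have "\<exists>c<r. p \<le> card (fib c)"
    by (metis leD le_less_linear mult.commute)
  then obtain c where "p \<le> card (fib c)" by blast
  then obtain g where g: "inj_on g {..<p}" "g ` {..<p} \<subseteq> fib c"
    using card_le_inj[of "{..<p}" "fib c"] by (auto simp: fib_def)
  show ?thesis
  proof (rule graph_leI[where \<phi> = "fst \<circ> \<phi> \<circ> g"])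
    show "(fst \<circ> \<phi> \<circ> g) v \<in> pverts G" if "v \<in> pverts (complete_graph p)" for v
      using that g \<phi> by (force simp: complete_graph_def fib_def graph_map_def disj_prod_def)
    fix u v assume "(u, v) \<in> parcs (complete_graph p)"
    then have "g u \<in> fib c" "g v \<in> fib c" "g u \<noteq> g v"
      using g by (auto simp: complete_graph_def inj_on_def)
    moreover from this have "(\<phi> (g u), \<phi> (g v)) \<in> parcs (disj_prod G (complete_graph r))"
      using \<phi> by (auto simp: graph_map_def complete_graph_def fib_def)
    ultimately show "((fst \<circ> \<phi> \<circ> g) u, (fst \<circ> \<phi> \<circ> g) v) \<in> parcs G"
      by (auto simp: disj_prod_def complete_graph_def fib_def)
  qed
qed

lemma clique_number_conv:
  assumes G: "simple_graph G"
  shows "clique_number G = Max {n. complete_graph n \<preceq> G}"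
    and "finite {n. complete_graph n \<preceq> G}"
proof -
  have finG: "finite (pverts G)" using G by (simp add: simple_graph_iff)
  have "n \<le> card (pverts G)" if le: "complete_graph n \<preceq> G" for n
  proof -
    obtain \<phi> where "graph_map \<phi> (complete_graph n) G" using le by (auto simp: graph_le_def)
    then have "inj_on \<phi> {..<n}" "\<phi> ` {..<n} \<subseteq> pverts G"
      using clique_inj_on[OF _ G] by (auto simp: graph_map_def complete_graph_def)
    then show ?thesis using card_inj_on_le[OF _ _ finG, of \<phi> "{..<n}"] by simp
  qed
  then show "finite {n. complete_graph n \<preceq> G}"
    by (auto intro: finite_subset[of _ "{..card (pverts G)}"])
  have "(\<exists>K. complete_digraph n (with_proj K) \<and> subgraph (with_proj K) (with_proj G)) \<longleftrightarrow> complete_graph n \<preceq> G"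
    for n
  proof
    assume "\<exists>K. complete_digraph n (with_proj K) \<and> subgraph (with_proj K) (with_proj G)"
    then obtain K where "complete_digraph n (with_proj K)" "subgraph (with_proj K) (with_proj G)"
      by blast
    then have K: "finite (pverts K)" "card (pverts K) = n"
      "parcs K = {(u, v). (u, v) \<in> pverts K \<times> pverts K \<and> u \<noteq> v}"
      "pverts K \<subseteq> pverts G" "parcs K \<subseteq> parcs G"
      by (simp_all add: complete_digraph_pair_def subgraph_def)
    then obtain g where "inj_on g {..<n}" "g ` {..<n} \<subseteq> pverts K"
      using card_le_inj[of "{..<n}" "pverts K"] by (metis card_lessThan finite_lessThan order_refl)
    then show "complete_graph n \<preceq> G"
      by (rule clique_imp_complete_graph_le) (use K(3-5) in blast)+
  next
    assume "complete_graph n \<preceq> G"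
    then obtain \<phi> where \<phi>: "graph_map \<phi> (complete_graph n) G" by (auto simp: graph_le_def)
    note inj = clique_inj_on[OF \<phi> G]
    define K where "K = \<lparr> pverts = \<phi> ` {..<n},
      parcs = {(u, v). (u, v) \<in> \<phi> ` {..<n} \<times> \<phi> ` {..<n} \<and> u \<noteq> v} \<rparr>"
    have KG: "pverts K \<subseteq> pverts G" "parcs K \<subseteq> parcs G"
      using \<phi> by (auto simp: K_def graph_map_def complete_graph_def)
    interpret pair_graph G using G by (simp add: simple_graph_def)
    have "complete_digraph n (with_proj K)"
      using inj by (auto simp: complete_digraph_pair_def K_def card_image)
    moreover have "subgraph (with_proj K) (with_proj G)"
      unfolding subgraph_def using KG wf_digraph
      by (auto simp: compatible_def wf_digraph_wp_iff K_def pair_wf_digraph_def)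
    ultimately show "\<exists>K. complete_digraph n (with_proj K) \<and> subgraph (with_proj K) (with_proj G)"
      by blast
  qed
  then show "clique_number G = Max {n. complete_graph n \<preceq> G}"
    by (simp add: clique_number_def)
qed

lemma le_clique_number_iff:
  assumes "simple_graph G"
  shows "n \<le> clique_number G \<longleftrightarrow> complete_graph n \<preceq> G"
proof
  assume n: "n \<le> clique_number G"
  have "complete_graph 1 \<preceq> G" using assms by (rule complete_one_le)
  then have "complete_graph (clique_number G) \<preceq> G"
    using Max_in[OF clique_number_conv(2)[OF assms]] clique_number_conv(1)[OF assms] by auto
  then show "complete_graph n \<preceq> G"
    using complete_mono[OF n] graph_le_trans by blast
next
  assume "complete_graph n \<preceq> G"
  then show "n \<le> clique_number G"
    using Max_ge[OF clique_number_conv(2)[OF assms]] clique_number_conv(1)[OF assms] by auto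
qed

lemma clique_number_pos: "simple_graph G \<Longrightarrow> clique_number G \<ge> 1"
  using le_clique_number_iff[of G 1] complete_one_le[of G] by simp

section \<open>The ordered monoid of graph classes\<close>

text \<open>
  Monotone invariants cannot distinguish graphs that map to each other, so this quotient, which is coarser
  than isomorphism, loses nothing and turns the preorder into an order.
\<close>
quotient_type graph_class = "nat pair_pre_digraph" /
    partial: "\<lambda>G H. simple_graph G \<and> simple_graph H \<and> G \<preceq> H \<and> H \<preceq> G"
  by (rule part_equivpI)
    (use simple_graph_complete[of 1] graph_le_refl graph_le_trans in
      \<open>auto intro!: sympI transpI simp del: One_nat_def\<close>)

lemma prod_encode_prod:
  assumes "simple_graph G" "simple_graph H"
  shows "simple_graph (relabel prod_encode (disj_prod G H))"
    and "relabel prod_encode (disj_prod G H) \<preceq> disj_prod G H"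
    and "disj_prod G H \<preceq> relabel prod_encode (disj_prod G H)"
  using digraph_iso_relabel(2) relabel_graph_le simple_graph_disj_prod[OF assms] inj_prod_encode
  by blast+

instantiation graph_class :: ordered_comm_monoid_mult
begin

lift_definition less_eq_graph_class :: "graph_class \<Rightarrow> graph_class \<Rightarrow> bool" is "(\<preceq>)"
  by (blast intro: graph_le_trans)

definition less_graph_class :: "graph_class \<Rightarrow> graph_class \<Rightarrow> bool" where
  "x < y \<longleftrightarrow> x \<le> y \<and> \<not> y \<le> (x :: graph_class)"

lift_definition one_graph_class :: graph_class is "complete_graph 1"
  using simple_graph_complete[of 1] by (simp add: graph_le_refl)

lift_definition times_graph_class :: "graph_class \<Rightarrow> graph_class \<Rightarrow> graph_class"
  is "\<lambda>G H. relabel prod_encode (disj_prod G H)"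
  by (meson prod_encode_prod disj_prod_mono graph_le_trans)

instance
proof
  fix x y z :: graph_class
  show "x \<le> x"
    by transfer (simp add: graph_le_refl)
  show "x \<le> y \<Longrightarrow> y \<le> z \<Longrightarrow> x \<le> z"
    by transfer (blast intro: graph_le_trans)
  show "x \<le> y \<Longrightarrow> y \<le> x \<Longrightarrow> x = y"
    by transfer blast
  show "x < y \<longleftrightarrow> x \<le> y \<and> \<not> y \<le> x"
    by (rule less_graph_class_def)
  show "x \<le> y \<Longrightarrow> z * x \<le> z * y"
    by transfer (meson prod_encode_prod disj_prod_mono graph_le_refl graph_le_trans)
  show "x * y * z = x * (y * z)"
  proof (transfer, clarsimp, intro conjI)
    fix G H J :: "nat pair_pre_digraph" assume s: "simple_graph G" "simple_graph H" "simple_graph J"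
    let ?p = "\<lambda>G H. relabel prod_encode (disj_prod G H)"
    note HJ = prod_encode_prod[OF s(2,3)] and GH = prod_encode_prod[OF s(1,2)]
    note l = prod_encode_prod[OF GH(1) s(3)] and r = prod_encode_prod[OF s(1) HJ(1)]
    show "simple_graph (?p (?p G H) J)" "simple_graph (?p G (?p H J))"
      by (rule l r)+
    show "?p (?p G H) J \<preceq> ?p G (?p H J)"
      using l(2) disj_prod_mono[OF GH(2) graph_le_refl] disj_prod_assoc(1)
        disj_prod_mono[OF graph_le_refl HJ(3)] r(3) by (meson graph_le_trans)
    show "?p G (?p H J) \<preceq> ?p (?p G H) J"
      using r(2) disj_prod_mono[OF graph_le_refl HJ(2)] disj_prod_assoc(2)
        disj_prod_mono[OF GH(3) graph_le_refl] l(3) by (meson graph_le_trans)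
  qed
  show "x * y = y * x"
    by transfer (meson prod_encode_prod disj_prod_commute graph_le_trans)
  show "1 * x = x"
    using simple_graph_complete[of 1]
    by (transfer, simp del: One_nat_def) (meson prod_encode_prod disj_prod_one graph_le_trans)
qed

end

text \<open>
  Powers of a graph have lists as vertices, so classes are needed for graphs over every vertex type.
\<close>
definition class_of :: "'a pair_pre_digraph \<Rightarrow> graph_class" where
  "class_of G = abs_graph_class (SOME H. simple_graph H \<and> G \<preceq> H \<and> H \<preceq> G)"

lemma class_of_rep:
  assumes "simple_graph G"
  obtains H where "simple_graph H" "G \<preceq> H" "H \<preceq> G" "class_of G = abs_graph_class H"
proof -
  obtain h :: "_ \<Rightarrow> nat" where "inj_on h (pverts G)"
    using assms finite_imp_inj_to_nat_seg[of "pverts G"] by (auto simp: simple_graph_iff)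
  then have "\<exists>H :: nat pair_pre_digraph. simple_graph H \<and> G \<preceq> H \<and> H \<preceq> G"
    using digraph_iso_relabel(2)[OF assms] relabel_graph_le[OF assms] by blast
  from someI_ex[OF this] show ?thesis
    by (intro that) (auto simp: class_of_def)
qed

lemma class_of_le_iff:
  assumes "simple_graph G" "simple_graph H"
  shows "class_of G \<le> class_of H \<longleftrightarrow> G \<preceq> H"
proof -
  obtain G' where G': "simple_graph G'" "G \<preceq> G'" "G' \<preceq> G" "class_of G = abs_graph_class G'"
    using class_of_rep[OF assms(1)] .
  obtain H' where H': "simple_graph H'" "H \<preceq> H'" "H' \<preceq> H" "class_of H = abs_graph_class H'"
    using class_of_rep[OF assms(2)] .
  show ?thesis
    using G' H' by (auto simp: less_eq_graph_class.abs_eq graph_le_refl intro: graph_le_trans)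
qed

lemma class_of_eqI:
  assumes "simple_graph G" "simple_graph H" "G \<preceq> H" "H \<preceq> G"
  shows "class_of G = class_of H"
  using assms by (intro antisym) (simp_all add: class_of_le_iff)

lemma class_of_nat:
  assumes "simple_graph G"
  shows "class_of G = abs_graph_class G"
proof -
  obtain H where "simple_graph H" "G \<preceq> H" "H \<preceq> G" "class_of G = abs_graph_class H"
    using class_of_rep[OF assms] .
  then show ?thesis
    using assms Quotient3_rel_abs[OF Quotient3_graph_class, of H G] by simp
qed

lemma class_of_surj:
  obtains G :: "nat pair_pre_digraph" where "simple_graph G" "x = class_of G"
proof -
  have "\<exists>G :: nat pair_pre_digraph. simple_graph G \<and> x = class_of G"
    by (induction x rule: graph_class.abs_induct) (metis class_of_nat)
  then show ?thesis using that by blast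
qed

lemma class_of_disj_prod:
  assumes "simple_graph G" "simple_graph H"
  shows "class_of (disj_prod G H) = class_of G * class_of H"
proof -
  obtain G' where G': "simple_graph G'" "G \<preceq> G'" "G' \<preceq> G" "class_of G = abs_graph_class G'"
    using class_of_rep[OF assms(1)] .
  obtain H' where H': "simple_graph H'" "H \<preceq> H'" "H' \<preceq> H" "class_of H = abs_graph_class H'"
    using class_of_rep[OF assms(2)] .
  note enc = prod_encode_prod[OF G'(1) H'(1)]
  have "class_of G * class_of H = class_of (relabel prod_encode (disj_prod G' H'))"
    using G' H' enc(1) by (simp add: times_graph_class.abs_eq graph_le_refl class_of_nat)
  also have "\<dots> = class_of (disj_prod G H)"
    using enc(1) simple_graph_disj_prod[OF assms]
      graph_le_trans[OF enc(2) disj_prod_mono[OF G'(3) H'(3)]]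
      graph_le_trans[OF disj_prod_mono[OF G'(2) H'(2)] enc(3)]
    by (intro class_of_eqI)
  finally show ?thesis ..
qed

lemma class_of_one: "class_of (complete_graph 1) = 1"
  unfolding one_graph_class_def by (intro class_of_nat simple_graph_complete) simp

lemma class_of_disj_power:
  assumes "simple_graph G"
  shows "class_of (disj_power G n) = class_of G ^ n"
proof (induction n)
  case 0
  have "simple_graph (disj_power G 0)"
    using assms by (rule simple_graph_disj_power)
  moreover have "disj_power G 0 \<preceq> complete_graph 1"
    by (rule graph_leI[where \<phi> = "\<lambda>_. 0"]) (auto simp: complete_graph_def)
  ultimately have "class_of (disj_power G 0) = class_of (complete_graph 1)"
    by (intro class_of_eqI complete_one_le simple_graph_complete) auto
  then show ?case by (simp add: class_of_one del: One_nat_def)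
next
  case (Suc n)
  have s: "simple_graph (disj_prod G (disj_power G n))"
    using assms by (intro simple_graph_disj_prod simple_graph_disj_power)
  have "class_of (disj_power G (Suc n)) = class_of (disj_prod G (disj_power G n))"
    using relabel_graph_le[OF s inj_on_Cons] simple_graph_disj_power[OF assms, of "Suc n"] s
    by (intro class_of_eqI) auto
  then show ?case
    using Suc assms by (simp add: class_of_disj_prod simple_graph_disj_power)
qed

section \<open>Classes of complete graphs\<close>

abbreviation clique_class :: "nat \<Rightarrow> graph_class" where
  "clique_class n \<equiv> class_of (complete_graph n)"

lemma clique_class_mult:
  "m > 0 \<Longrightarrow> n > 0 \<Longrightarrow> clique_class (m * n) = clique_class m * clique_class n"
  using disj_prod_complete[of m n]
  by (simp flip: class_of_disj_prod add: simple_graph_complete)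
    (intro class_of_eqI simple_graph_complete simple_graph_disj_prod, auto)

lemma clique_class_power: "m > 0 \<Longrightarrow> clique_class (m ^ k) = clique_class m ^ k"
proof (induction k)
  case 0
  then show ?case by (simp add: class_of_one[unfolded One_nat_def])
next
  case (Suc k)
  then show ?case by (simp add: clique_class_mult)
qed

lemma clique_class_mono: "0 < m \<Longrightarrow> m \<le> n \<Longrightarrow> clique_class m \<le> clique_class n"
  by (simp add: class_of_le_iff simple_graph_complete complete_mono)

lemma clique_class_le_iff: "0 < m \<Longrightarrow> 0 < n \<Longrightarrow> clique_class m \<le> clique_class n \<longleftrightarrow> m \<le> n"
proof
  assume mn: "0 < m" "0 < n" "clique_class m \<le> clique_class n"
  then obtain \<phi> where \<phi>: "graph_map \<phi> (complete_graph m) (complete_graph n)"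
    by (auto simp: class_of_le_iff simple_graph_complete graph_le_def)
  then have "\<phi> ` {..<m} \<subseteq> {..<n}"
    by (auto simp: graph_map_def complete_graph_def)
  then show "m \<le> n"
    using card_inj_on_le[OF clique_inj_on[OF \<phi> simple_graph_complete[OF mn(2)]], of "{..<n}"] by simp
qed (rule clique_class_mono)

lemma clique_class_le_power_iff:
  assumes "simple_graph G" "m > 0"
  shows "clique_class m \<le> class_of G ^ n \<longleftrightarrow> m \<le> clique_number (disj_power G n)"
  using assms
  by (simp add: le_clique_number_iff simple_graph_disj_power simple_graph_complete
      flip: class_of_disj_power class_of_le_iff)

lemma clique_class_cancel:
  assumes "p > 0" "r > 0" "clique_class p * clique_class r \<le> x * clique_class r"
  shows "clique_class p \<le> x"
proof -
  obtain G :: "nat pair_pre_digraph" where G: "simple_graph G" "x = class_of G"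
    by (rule class_of_surj)
  have "class_of (complete_graph (p * r)) \<le> class_of (disj_prod G (complete_graph r))"
    using assms G by (simp add: clique_class_mult class_of_disj_prod simple_graph_complete)
  then have "complete_graph (p * r) \<preceq> disj_prod G (complete_graph r)"
    using assms G by (simp add: class_of_le_iff simple_graph_complete simple_graph_disj_prod)
  then show ?thesis
    using complete_cancel[OF G(1) assms(2)] assms G by (simp add: class_of_le_iff simple_graph_complete)
qed

interpretation graph_monoid: bounded_monoid "clique_class 2"
proof
  fix x :: graph_class
  obtain G :: "nat pair_pre_digraph" where G: "simple_graph G" "x = class_of G"
    by (rule class_of_surj)
  show "1 \<le> x"
    using G complete_one_le[OF G(1)] simple_graph_complete[of 1]
    by (simp add: class_of_le_iff flip: class_of_one)
  let ?n = "card (pverts G)"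
  have n: "?n > 0" using G(1) by (simp add: simple_graph_iff card_gt_0_iff)
  have "x \<le> clique_class ?n"
    using G graph_le_complete_card[OF G(1)] simple_graph_complete[OF n] by (simp add: class_of_le_iff)
  also have "\<dots> \<le> clique_class (2 ^ ?n)"
    using n by (intro clique_class_mono less_imp_le less_exp)
  finally show "\<exists>n. x \<le> clique_class 2 ^ n"
    by (auto simp: clique_class_power)
qed

section \<open>Admissible invariants as functions on graph classes\<close>

locale clique_valuation =
  fixes F :: "graph_class \<Rightarrow> real"
  assumes mult: "F (x * y) = F x * F y"
    and mono: "x \<le> y \<Longrightarrow> F x \<le> F y"
    and pos: "F x > 0"
    and two: "F (clique_class 2) = 2"
begin

lemma power: "F (x ^ n) = F x ^ n"
proof (induction n)
  case 0
  have "F 1 = F 1 * F 1" using mult[of 1 1] by simp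
  then show ?case using pos[of 1] by simp
qed (simp add: mult)

text \<open>
  Only powers of \<open>2\<close> have a prescribed value. A power \<open>m\<^sup>k\<close> exceeds one of them by a factor of less
  than \<open>2\<close>, and this loss disappears in the \<open>k\<close>-th root as \<open>k\<close> grows.
\<close>
lemma clique_class_ge:
  assumes "m > 0"
  shows "real m \<le> F (clique_class m)"
proof (rule ccontr)
  let ?F = "F (clique_class m)"
  assume "\<not> real m \<le> ?F"
  then have "1 < real m / ?F"
    using pos[of "clique_class m"] by simp
  then obtain k where "2 < (real m / ?F) ^ k"
    using real_arch_pow by blast
  then have k: "2 * ?F ^ k < real m ^ k"
    using pos[of "clique_class m"] by (simp add: power_divide field_simps)
  obtain j where j: "2 ^ j \<le> m ^ k" "m ^ k < 2 ^ Suc j"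
    using ex_power_ivl1[of 2 "m ^ k"] assms by auto
  have "clique_class 2 ^ j \<le> clique_class m ^ k"
    using j(1) assms clique_class_mono[of "2 ^ j" "m ^ k"] by (simp add: clique_class_power)
  then have "2 ^ j \<le> ?F ^ k"
    using mono by (metis power two)
  moreover have "real m ^ k < 2 * 2 ^ j"
    using j(2) by (metis of_nat_less_iff of_nat_numeral of_nat_power power_Suc)
  ultimately show False using k by linarith
qed

end

lemma class_of_digraph_iso:
  assumes "simple_graph G" "simple_graph H" "digraph_iso (with_proj G) (with_proj H)"
  shows "class_of G = class_of H"
proof -
  interpret pair_graph G using assms(1) by (simp add: simple_graph_def)
  show ?thesis
    using assms digraph_iso_swap[OF wf_digraph assms(3)]
    by (intro class_of_eqI digraph_iso_imp_graph_le)
qed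

lemma inv_value_class:
  assumes "graph_invariant f" "\<And>H. simple_graph H \<Longrightarrow> f H = F (class_of H)" "simple_graph G"
  shows "inv_value f G = F (class_of G)"
proof -
  obtain H :: "nat pair_pre_digraph" where H: "simple_graph H" "digraph_iso (with_proj G) (with_proj H)"
    using inv_value_witness[OF assms(3)] by blast
  show ?thesis
    using inv_value_eq[OF assms(1,3) H] assms(2)[OF H(1)] class_of_digraph_iso[OF assms(3) H] by simp
qed

lemma complete_digraph_two_class:
  assumes "complete_digraph 2 (with_proj K)"
  shows "class_of K = clique_class 2" "simple_graph K"
proof -
  have K: "finite (pverts K)" "card (pverts K) = 2"
    "parcs K = {(u, v). (u, v) \<in> pverts K \<times> pverts K \<and> u \<noteq> v}"
    using assms by (simp_all add: complete_digraph_pair_def)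
  then show s: "simple_graph K"
    by (auto simp: simple_graph_iff)
  obtain g where "bij_betw g {..<2::nat} (pverts K)"
    using ex_bij_betw_nat_finite[OF K(1)] K(2) by (auto simp: atLeast0LessThan)
  then have "complete_graph 2 \<preceq> K"
    using K(3) by (intro clique_imp_complete_graph_le[where \<phi> = g and V = "pverts K"]) (auto simp: bij_betw_def)
  then show "class_of K = clique_class 2"
    using s graph_le_complete_card[OF s] K(2)
    by (intro class_of_eqI simple_graph_complete) simp_all
qed

lemma admissible_of_valuation:
  assumes "clique_valuation F"
  shows "admissible_invariant (\<lambda>H. F (class_of H))"
proof -
  interpret clique_valuation F by fact
  have inv: "graph_invariant (\<lambda>H. F (class_of H))"
    unfolding graph_invariant_def using class_of_digraph_iso by metis
  show ?thesis
    unfolding admissible_invariant_def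
  proof (intro conjI allI impI)
    show "inv_value (\<lambda>H. F (class_of H)) (disj_prod H1 H2) = F (class_of H1) * F (class_of H2)"
      if "simple_graph H1 \<and> simple_graph H2" for H1 H2 :: "nat pair_pre_digraph"
      using that inv_value_class[OF inv, of F "disj_prod H1 H2"]
      by (simp add: simple_graph_disj_prod class_of_disj_prod mult)
    show "F (class_of H1) \<le> F (class_of H2)"
      if "simple_graph H1 \<and> simple_graph H2 \<and> (\<exists>\<phi>. graph_map \<phi> H1 H2)" for H1 H2 :: "nat pair_pre_digraph"
      using that by (intro mono) (simp add: class_of_le_iff graph_le_def)
    show "F (class_of K) = 2" if "complete_digraph 2 (with_proj K)" for K :: "nat pair_pre_digraph"
      using complete_digraph_two_class(1)[OF that] two by simp
  qed (simp_all add: inv pos)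
qed

lemma valuation_of_admissible:
  assumes f: "admissible_invariant f"
  obtains F where "clique_valuation F" "\<And>H. simple_graph H \<Longrightarrow> f H = F (class_of H)"
proof -
  have inv: "graph_invariant f"
    and f_pos: "\<And>H. simple_graph H \<Longrightarrow> f H > 0"
    and f_mono: "\<And>G H. simple_graph G \<Longrightarrow> simple_graph H \<Longrightarrow> G \<preceq> H \<Longrightarrow> f G \<le> f H"
    and f_mult: "\<And>G H. simple_graph G \<Longrightarrow> simple_graph H \<Longrightarrow> inv_value f (disj_prod G H) = f G * f H"
    and f_two: "\<And>K. complete_digraph 2 (with_proj K) \<Longrightarrow> f K = 2"
    using f unfolding admissible_invariant_def graph_le_def by blast+
  define F where "F x = f (SOME G. simple_graph G \<and> class_of G = x)" for x
  have F: "f G = F (class_of G)" if G: "simple_graph G" for G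
  proof -
    let ?P = "\<lambda>H :: nat pair_pre_digraph. simple_graph H \<and> class_of H = class_of G"
    have "?P (SOME H. ?P H)"
      by (rule someI[of ?P G]) (use G in simp)
    then obtain H where H: "simple_graph H" "class_of H = class_of G" "F (class_of G) = f H"
      unfolding F_def by blast
    then have "G \<preceq> H" "H \<preceq> G"
      using class_of_le_iff[OF G H(1)] class_of_le_iff[OF H(1) G] by simp_all
    then show ?thesis
      using f_mono[OF G H(1)] f_mono[OF H(1) G] H(3) by simp
  qed
  have "clique_valuation F"
  proof
    fix x y
    obtain G :: "nat pair_pre_digraph" where G: "simple_graph G" "x = class_of G"
      by (rule class_of_surj)
    obtain H :: "nat pair_pre_digraph" where H: "simple_graph H" "y = class_of H"
      by (rule class_of_surj)
    show "F (x * y) = F x * F y"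
      using f_mult[OF G(1) H(1)] inv_value_class[OF inv F simple_graph_disj_prod[OF G(1) H(1)]] G H F
      by (simp add: class_of_disj_prod)
    show "F x \<le> F y" if "x \<le> y"
      using that G H f_mono[OF G(1) H(1)] F by (simp add: class_of_le_iff)
    show "F x > 0"
      using G F f_pos by metis
  next
    have "complete_digraph 2 (with_proj (complete_graph 2))"
      by (auto simp: complete_digraph_pair_def complete_graph_def)
    then show "F (clique_class 2) = 2"
      using f_two F[OF simple_graph_complete[of 2]] by simp
  qed
  then show ?thesis using that F by blast
qed

section \<open>The Shannon capacity\<close>

text \<open>
  Fekete's lemma. For fixed \<open>m\<close> the multiples of \<open>m\<close> have quotient at least \<open>b m / m\<close>, and rounding
  \<open>n\<close> down to a multiple of \<open>m\<close> costs at most \<open>b m / n\<close>, which vanishes.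
\<close>
lemma superadditive_limit:
  fixes b :: "nat \<Rightarrow> real"
  assumes super: "\<And>m n. b m + b n \<le> b (m + n)" and nonneg: "\<And>n. 0 \<le> b n"
    and bdd: "\<And>n. b n \<le> c * real n"
  defines "s \<equiv> SUP n\<in>{1..}. b n / real n"
  shows "(\<lambda>n. b n / real n) \<longlonglongrightarrow> s" "b n \<le> real n * s"
proof -
  have bddS: "bdd_above ((\<lambda>n. b n / real n) ` {1..})"
    using bdd by (intro bdd_aboveI2[where M = c]) (auto simp: field_simps)
  have le_s: "b n / real n \<le> s" if "n \<ge> 1" for n
    unfolding s_def using that by (intro cSUP_upper bddS) auto
  have "b 0 = 0"
    using super[of 0 0] nonneg[of 0] by simp
  then show "b n \<le> real n * s" for n
    using le_s[of n] by (cases "n = 0") (auto simp: field_simps)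
  have mult: "real q * b m \<le> b (q * m)" for q m
  proof (induction q)
    case (Suc q)
    then show ?case using super[of m "q * m"] by (simp add: algebra_simps)
  qed (simp add: nonneg)
  show "(\<lambda>n. b n / real n) \<longlonglongrightarrow> s"
  proof (rule order_tendstoI)
    fix a assume "a < s"
    then obtain m where m: "m \<ge> 1" "a < b m / real m"
      unfolding s_def by (subst (asm) less_cSUP_iff[OF _ bddS]) auto
    have "(\<lambda>n. b m / real m - b m / real n) \<longlonglongrightarrow> b m / real m - 0"
      by (intro tendsto_intros lim_const_over_n)
    then have "\<forall>\<^sub>F n in sequentially. a < b m / real m - b m / real n"
      using m(2) by (intro order_tendstoD(1)[where y = "b m / real m - 0"]) auto
    then show "\<forall>\<^sub>F n in sequentially. a < b n / real n"
      using eventually_ge_at_top[of 1]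
    proof eventually_elim
      case (elim n)
      have "real n = real (n div m) * real m + real (n mod m)"
        by (metis div_mult_mod_eq of_nat_add of_nat_mult)
      also have "\<dots> \<le> (real (n div m) + 1) * real m"
        using m(1) by (simp add: algebra_simps less_imp_le)
      finally have "real n / real m - 1 \<le> real (n div m)"
        using m(1) by (simp add: field_simps)
      then have "(real n / real m - 1) * b m \<le> real (n div m) * b m"
        by (intro mult_right_mono nonneg)
      also have "\<dots> \<le> b (n div m * m)" by (rule mult)
      also have "\<dots> \<le> b n"
        using super[of "n div m * m" "n mod m"] nonneg[of "n mod m"] by simp
      finally have "(real n / real m - 1) * b m / real n \<le> b n / real n"
        by (rule divide_right_mono) simp
      moreover have "(real n / real m - 1) * b m / real n = b m / real m - b m / real n"
        using m(1) elim(2) by (simp add: field_simps)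
      ultimately show ?case using elim(1) by simp
    qed
  next
    fix a assume "s < a"
    show "\<forall>\<^sub>F n in sequentially. b n / real n < a"
      using eventually_ge_at_top[of 1]
      by eventually_elim (use le_s \<open>s < a\<close> in \<open>force intro: le_less_trans\<close>)
  qed
qed

text \<open>
  Cliques multiply under disjunctive products, so the logarithms of the clique numbers are superadditive.
\<close>
lemma root_clique_number_limit:
  assumes A: "simple_graph A"
  defines "w \<equiv> \<lambda>n. clique_number (disj_power A n)"
  obtains t where "(\<lambda>n. root n (real (w n))) \<longlonglongrightarrow> 2 powr t"
    "t \<ge> 0" "\<And>n. log 2 (real (w n)) \<le> real n * t"
proof -
  let ?a = "class_of A"
  define b where "b n = log 2 (real (w n))" for n
  have w: "w n \<ge> 1" for n
    unfolding w_def using A by (intro clique_number_pos simple_graph_disj_power)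
  have w_iff: "m \<le> w n \<longleftrightarrow> clique_class m \<le> ?a ^ n" if "m > 0" for m n
    unfolding w_def using clique_class_le_power_iff[OF A that] by simp
  have "b m + b n \<le> b (m + n)" for m n
  proof -
    have "clique_class (w m * w n) \<le> ?a ^ (m + n)"
      using w[of m] w[of n] w_iff[of "w m" m] w_iff[of "w n" n]
      by (simp add: clique_class_mult power_add mult_le_mono)
    then have "w m * w n \<le> w (m + n)"
      using w_iff[of "w m * w n" "m + n"] w[of m] w[of n] by simp
    then have "real (w m) * real (w n) \<le> real (w (m + n))"
      by (metis of_nat_le_iff of_nat_mult)
    then have "log 2 (real (w m) * real (w n)) \<le> log 2 (real (w (m + n)))"
      using w[of m] w[of n] by (intro log_mono) auto
    then show ?thesis
      using w[of m] w[of n] unfolding b_def by (simp add: log_mult)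
  qed
  moreover have nonneg: "0 \<le> b n" for n
    unfolding b_def using w[of n] by simp
  moreover obtain c where c: "?a \<le> clique_class 2 ^ c"
    using graph_monoid.bounded by blast
  have "b n \<le> real c * real n" for n
  proof -
    have "clique_class (w n) \<le> ?a ^ n"
      using w_iff[of "w n" n] w[of n] by simp
    also have "\<dots> \<le> clique_class (2 ^ (c * n))"
      using power_le_mono[OF c, of n] by (simp add: clique_class_power power_mult)
    finally have "w n \<le> 2 ^ (c * n)"
      using w[of n] by (simp add: clique_class_le_iff)
    then have "real (w n) \<le> 2 ^ (c * n)"
      by (metis of_nat_le_iff of_nat_numeral of_nat_power)
    then show ?thesis
      unfolding b_def using w[of n] by (simp add: log_le_iff powr_realpow flip: of_nat_mult)
  qed
  ultimately have lim: "(\<lambda>n. b n / real n) \<longlonglongrightarrow> (SUP n\<in>{1..}. b n / real n)"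
    and le: "\<And>n. b n \<le> real n * (SUP n\<in>{1..}. b n / real n)"
    by (rule superadditive_limit)+
  have "\<forall>\<^sub>F n in sequentially. root n (real (w n)) = 2 powr (b n / real n)"
    using eventually_gt_at_top[of 0]
  proof eventually_elim
    case (elim n)
    have "2 powr (b n / real n) = (2 powr b n) powr (1 / real n)"
      by (simp add: powr_powr)
    also have "2 powr b n = real (w n)"
      unfolding b_def using w[of n] by (intro powr_log_cancel) auto
    finally show ?case
      using elim w[of n] by (simp add: root_powr_inverse)
  qed
  moreover have "(\<lambda>n. 2 powr (b n / real n)) \<longlonglongrightarrow> 2 powr (SUP n\<in>{1..}. b n / real n)"
    by (intro tendsto_intros lim) simp
  ultimately have "(\<lambda>n. root n (real (w n))) \<longlonglongrightarrow> 2 powr (SUP n\<in>{1..}. b n / real n)"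
    by (simp add: filterlim_cong)
  moreover have "0 \<le> (SUP n\<in>{1..}. b n / real n)"
    using le[of 1] nonneg[of 1] by simp
  ultimately show ?thesis
    using that le unfolding b_def by blast
qed

text \<open>
  The abstract extension theorem applies because a clique of size \<open>2 ^ (d + m)\<close> in the product of a power
  of \<open>A\<close> with the complete graph on \<open>2 ^ m\<close> vertices leaves a clique of size \<open>2 ^ d\<close> in that power,
  whose clique number bounds \<open>d\<close>.
\<close>
lemma optimal_valuation:
  assumes A: "simple_graph A" and t: "t \<ge> 0"
    and w: "\<And>n. log 2 (real (clique_number (disj_power A n))) \<le> real n * t"
  obtains F where "clique_valuation F" "F (class_of A) \<le> 2 powr t"
proof -
  let ?u = "clique_class 2" and ?a = "class_of A"
  have "real m \<le> real m' + real j * t" if le: "?u ^ m \<le> ?a ^ j * ?u ^ m'" for m m' j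
  proof (cases "m \<le> m'")
    case True
    then show ?thesis using t by (simp add: add_increasing2)
  next
    case False
    define d where "d = m - m'"
    have m: "m = d + m'" using False by (simp add: d_def)
    have "clique_class (2 ^ d) * clique_class (2 ^ m') \<le> ?a ^ j * clique_class (2 ^ m')"
      using le by (simp add: m clique_class_power power_add)
    then have "clique_class (2 ^ d) \<le> ?a ^ j"
      by (rule clique_class_cancel[rotated 2]) auto
    then have "2 ^ d \<le> clique_number (disj_power A j)"
      by (subst (asm) clique_class_le_power_iff[OF A]) auto
    then have "2 ^ d \<le> real (clique_number (disj_power A j))"
      by (metis of_nat_le_iff of_nat_numeral of_nat_power)
    then have "log 2 (2 ^ d) \<le> log 2 (real (clique_number (disj_power A j)))"
      by (intro log_mono) auto
    then have "real d \<le> real j * t"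
      using w[of j] by (simp add: log_nat_power)
    then show ?thesis by (simp add: m)
  qed
  then obtain \<phi> where \<phi>: "\<And>x y. \<phi> (x * y) = \<phi> x + \<phi> y" "\<And>x y. x \<le> y \<Longrightarrow> \<phi> x \<le> \<phi> y"
    "\<phi> ?u = 1" "\<phi> ?a \<le> t"
    using graph_monoid.additive_rate_exists[of ?a t] by blast
  have "clique_valuation (\<lambda>x. 2 powr \<phi> x)"
    by unfold_locales (simp_all add: \<phi> powr_add)
  then show ?thesis using that \<phi>(4) by simp
qed

theorem mainTheorem8:
  fixes G :: "'a pair_pre_digraph"
  assumes "simple_graph G"
  shows "shannon_capacity G =
           (INF f \<in> {f. admissible_invariant f}. inv_value f (complement_graph G))"
proof -
  define A where "A = complement_graph G"
  have A: "simple_graph A"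
    unfolding A_def using assms by (rule simple_graph_complement)
  let ?w = "\<lambda>n. real (clique_number (disj_power A n))"
  obtain t where lim: "(\<lambda>n. root n (?w n)) \<longlonglongrightarrow> 2 powr t"
    and t: "t \<ge> 0" "\<And>n. log 2 (?w n) \<le> real n * t"
    using root_clique_number_limit[OF A] by blast
  have lower: "2 powr t \<le> inv_value f A" if f: "admissible_invariant f" for f
  proof -
    obtain F where F: "clique_valuation F" "\<And>H. simple_graph H \<Longrightarrow> f H = F (class_of H)"
      using valuation_of_admissible[OF f] by blast
    interpret clique_valuation F by fact
    have "root n (?w n) \<le> F (class_of A)" if "n > 0" for n
    proof -
      have w: "clique_number (disj_power A n) > 0"
        using clique_number_pos[OF simple_graph_disj_power[OF A]] by (simp add: Suc_le_eq)
      have "?w n \<le> F (clique_class (clique_number (disj_power A n)))"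
        using w by (rule clique_class_ge)
      also have "\<dots> \<le> F (class_of A ^ n)"
        using w by (intro mono) (simp add: clique_class_le_power_iff[OF A])
      also have "\<dots> = F (class_of A) ^ n"
        by (rule power)
      finally show ?thesis
        using that pos[of "class_of A"] by (metis less_imp_le real_root_le_iff real_root_power_cancel)
    qed
    then have "2 powr t \<le> F (class_of A)"
      by (intro tendsto_upperbound[OF lim]) (auto intro: eventually_mono[OF eventually_gt_at_top[of 0]])
    also have "\<dots> = inv_value f A"
      using inv_value_class[of f F A, OF _ F(2) A] f by (simp add: admissible_invariant_def)
    finally show ?thesis .
  qed
  obtain F where F: "clique_valuation F" "F (class_of A) \<le> 2 powr t"
    using optimal_valuation[OF A t] by blast
  define f where "f = (\<lambda>H :: nat pair_pre_digraph. F (class_of H))"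
  have f: "admissible_invariant f"
    unfolding f_def using F(1) by (rule admissible_of_valuation)
  have upper: "inv_value f A \<le> 2 powr t"
    using inv_value_class[of f F A] f F(2) A by (simp add: admissible_invariant_def f_def)
  have "(INF f \<in> {f. admissible_invariant f}. inv_value f A) = 2 powr t"
  proof (rule antisym)
    show "(INF f \<in> {f. admissible_invariant f}. inv_value f A) \<le> 2 powr t"
      using lower f upper by (intro cINF_lower2[where x = f] bdd_belowI2[where m = "2 powr t"]) auto
    show "2 powr t \<le> (INF f \<in> {f. admissible_invariant f}. inv_value f A)"
      using lower f by (intro cINF_greatest) auto
  qed
  then show ?thesis
    using limI[OF lim] by (simp add: shannon_capacity_def A_def)
qed

end
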